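(* Let $\mathcal{C}\subseteq\mathbb{R}^{2n}$ be the set defined by the half-spaces $\mathcal{C}_i$ and index sets $\mathcal{L},\mathcal{I}^\ell$ as in the context. Suppose that (Assumption 1) $\operatorname{Proj}_n(\mathcal{C})$ is compact and, for every $I\in\mathcal{S}_\cap$, a point $y_I\in\mathcal{C}$ is chosen with $h_i(y_I)>0$ for all $i\in I$; let $\delta=\min_{I\in\mathcal{S}_\cap,\, i\in I}h_i(y_I)>0$. Then there exists a constant $c$ that depends only on the data $\{a_i,b_i\}_{i\in\mathcal{I}}$ defining $\{h_i\}_{i\in\mathcal{I}}$ (in particular, not on $\gamma$ or $\epsilon$) such that, for all $\gamma,\epsilon>0$ satisfying $\gamma\delta>\epsilon$, $$\|x_2\|\le\gamma c\quad\text{for all } x=(x_1,x_2)\in\mathcal{C}^s,$$ where $\mathcal{C}^s=\{x\in\mathbb{R}^{2n}: B(x)\ge 0\}$ is the 0-superlevel set of the function $B$ associated with $\gamma,\epsilon$.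
   Context: Points of $\mathbb{R}^{2n}$ are written $x=(x_1,x_2)$ with $x_1,x_2\in\mathbb{R}^n$; $\|\cdot\|$ is the Euclidean norm. For a set $S\subseteq\mathbb{R}^{2n}$, $\operatorname{Proj}_n(S)\subseteq\mathbb{R}^n$ is its projection on the first $n$ components. Half-spaces: let $\mathcal{I}=\{1,\dots,r\}$. For $i\in\mathcal{I}$, let $a_i\in\mathbb{R}^n$, $b_i\in\mathbb{R}$ with $\|a_i\|\ne 0$ and $b_i\neq 0$, such that for $i\ne i'$ the augmented vectors $(a_i,b_i)$ and $(a_{i'},b_{i'})$ are linearly independent. Set $h_i(x)=a_i^\top x_1+b_i$ and $\mathcal{C}_i=\{x\in\mathbb{R}^{2n} : h_i(x)\ge 0\}$. Desired safe set: $\mathcal{L}\subset\mathbb{N}$ is a nonempty finite index set and $\mathcal{I}^\ell\subseteq\mathcal{I}$ is nonempty for each $\ell\in\mathcal{L}$. Set $\mathcal{C}=\bigcup_{\ell\in\mathcal{L}}\bigcap_{i\in\mathcal{I}^\ell}\mathcal{C}_i$, assumed nonempty. $\mathcal{S}_\cap$ is the collection of all $I\subseteq\mathcal{I}$ such that $\left(\bigcap_{i\in I}\mathcal{C}_i\right)\cap\mathcal{C}\neq\emptyset$. Construction of $B$: given parameters $\gamma,\epsilon>0$, for $1\le i\le r$ put $B_i(x)=h_i(x)$ and $B_{i+r}(x)=a_i^\top x_2+\gamma(a_i^\top x_1+b_i)-\epsilon$. Put $\bar{\mathcal{L}}=\mathcal{L}$, $\bar{\mathcal{I}}^\ell=\mathcal{I}^\ell\cup\{i+r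 : i\in\mathcal{I}^\ell\}$, and $B(x)=\max_{\ell\in\bar{\mathcal{L}}}\min_{i\in\bar{\mathcal{I}}^\ell}B_i(x)$. *)

theory Defs
  imports "HOL-Analysis.Analysis"
begin

text \<open>
  Euclidean space of dimension \<open>2n\<close> is rendered as the product type \<open>(real ^ 'n) \<times> (real ^ 'n)\<close>, whose norm is the
  Euclidean one; \<open>fst\<close> and \<open>snd\<close> are the components \<open>x\<^sub>1\<close> and \<open>x\<^sub>2\<close>, and the projection of a set \<open>S\<close> on
  the first \<open>n\<close> components is \<open>fst ` S\<close>.  The families \<open>a\<close> and \<open>b\<close> are total functions on \<open>nat\<close>, of
  which only the values on \<open>{1..r}\<close> are used.
\<close>

type_synonym 'n state = "(real ^ 'n) \<times> (real ^ 'n)"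

text \<open>
  The condition \<open>u \<noteq> v\<close> is needed because \<open>independent {u, v}\<close> speaks about the set, which
  collapses to a singleton when \<open>u = v\<close>.
\<close>

definition halfspace_data :: "nat \<Rightarrow> (nat \<Rightarrow> real ^ 'n) \<Rightarrow> (nat \<Rightarrow> real) \<Rightarrow> bool" where
  "halfspace_data r a b \<longleftrightarrow>
     (\<forall>i\<in>{1..r}. norm (a i) \<noteq> 0 \<and> b i \<noteq> 0) \<and>
     (\<forall>i\<in>{1..r}. \<forall>j\<in>{1..r}. i \<noteq> j \<longrightarrow>
        (a i, b i) \<noteq> (a j, b j) \<and> independent {(a i, b i), (a j, b j)})"

definition h :: "(nat \<Rightarrow> real ^ 'n) \<Rightarrow> (nat \<Rightarrow> real) \<Rightarrow> nat \<Rightarrow> 'n state \<Rightarrow> real" where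
  "h a b i x = a i \<bullet> fst x + b i"

definition half_space :: "(nat \<Rightarrow> real ^ 'n) \<Rightarrow> (nat \<Rightarrow> real) \<Rightarrow> nat \<Rightarrow> 'n state set" where
  "half_space a b i = {x. h a b i x \<ge> 0}"

definition index_sets :: "nat \<Rightarrow> nat set \<Rightarrow> (nat \<Rightarrow> nat set) \<Rightarrow> bool" where
  "index_sets r L J \<longleftrightarrow>
     finite L \<and> L \<noteq> {} \<and> (\<forall>l\<in>L. J l \<subseteq> {1..r} \<and> J l \<noteq> {})"

definition desired_set ::
    "(nat \<Rightarrow> real ^ 'n) \<Rightarrow> (nat \<Rightarrow> real) \<Rightarrow> nat set \<Rightarrow> (nat \<Rightarrow> nat set) \<Rightarrow> 'n state set" where
  "desired_set a b L J = (\<Union>l\<in>L. \<Inter>i\<in>J l. half_space a b i)"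

definition S_cap ::
    "nat \<Rightarrow> (nat \<Rightarrow> real ^ 'n) \<Rightarrow> (nat \<Rightarrow> real) \<Rightarrow> nat set \<Rightarrow> (nat \<Rightarrow> nat set) \<Rightarrow> nat set set" where
  "S_cap r a b L J =
     {I. I \<subseteq> {1..r} \<and> (\<Inter>i\<in>I. half_space a b i) \<inter> desired_set a b L J \<noteq> {}}"

definition assumption1 ::
    "nat \<Rightarrow> (nat \<Rightarrow> real ^ 'n) \<Rightarrow> (nat \<Rightarrow> real) \<Rightarrow> nat set \<Rightarrow> (nat \<Rightarrow> nat set) \<Rightarrow>
     (nat set \<Rightarrow> 'n state) \<Rightarrow> bool" where
  "assumption1 r a b L J y \<longleftrightarrow>
     compact (fst ` desired_set a b L J) \<and>
     (\<forall>I\<in>S_cap r a b L J. y I \<in> desired_set a b L J \<and> (\<forall>i\<in>I. h a b i (y I) > 0))"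

text \<open>
  The minimum is over a finite set, which is nonempty as soon as \<open>desired_set a b L J\<close> is:
  some \<open>J l\<close> then belongs to \<open>S_cap r a b L J\<close>, and it has an element.
\<close>

definition delta ::
    "nat \<Rightarrow> (nat \<Rightarrow> real ^ 'n) \<Rightarrow> (nat \<Rightarrow> real) \<Rightarrow> nat set \<Rightarrow> (nat \<Rightarrow> nat set) \<Rightarrow>
     (nat set \<Rightarrow> 'n state) \<Rightarrow> real" where
  "delta r a b L J y = Min {h a b i (y I) |I i. I \<in> S_cap r a b L J \<and> i \<in> I}"

definition B_comp ::
    "nat \<Rightarrow> (nat \<Rightarrow> real ^ 'n) \<Rightarrow> (nat \<Rightarrow> real) \<Rightarrow> real \<Rightarrow> real \<Rightarrow> nat \<Rightarrow> 'n state \<Rightarrow> real" where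
  "B_comp r a b \<gamma> \<epsilon> k x =
     (if k \<le> r then h a b k x
      else a (k - r) \<bullet> snd x + \<gamma> * (a (k - r) \<bullet> fst x + b (k - r)) - \<epsilon>)"

definition J_bar :: "nat \<Rightarrow> (nat \<Rightarrow> nat set) \<Rightarrow> nat \<Rightarrow> nat set" where
  "J_bar r J l = J l \<union> {i + r |i. i \<in> J l}"

definition B ::
    "nat \<Rightarrow> (nat \<Rightarrow> real ^ 'n) \<Rightarrow> (nat \<Rightarrow> real) \<Rightarrow> nat set \<Rightarrow> (nat \<Rightarrow> nat set) \<Rightarrow>
     real \<Rightarrow> real \<Rightarrow> 'n state \<Rightarrow> real" where
  "B r a b L J \<gamma> \<epsilon> x = (MAX l\<in>L. MIN k\<in>J_bar r J l. B_comp r a b \<gamma> \<epsilon> k x)"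

definition safe_set ::
    "nat \<Rightarrow> (nat \<Rightarrow> real ^ 'n) \<Rightarrow> (nat \<Rightarrow> real) \<Rightarrow> nat set \<Rightarrow> (nat \<Rightarrow> nat set) \<Rightarrow>
     real \<Rightarrow> real \<Rightarrow> 'n state set" where
  "safe_set r a b L J \<gamma> \<epsilon> = {x. B r a b L J \<gamma> \<epsilon> x \<ge> 0}"

end

(* If B x \<ge> 0, some index l makes both x1 and the shifted point x1 + x2 / \<gamma> lie in the polyhedron
   cut out by J l: the shifted point satisfies a i \<bullet> z + b i \<ge> \<epsilon> / \<gamma> > 0.  That polyhedron lies in
   the compact projection of C, so norm x2 / \<gamma> is at most its diameter, and only finitely many
   polyhedra arise from subsets of {1..r}. *)
theory Submission
  imports Defs
begin

text \<open>This lives in the space of first components: the intersection of the sets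
  \<open>half_space a b i\<close> in the state space is the cylinder over it, which is unbounded
  whenever nonempty.\<close>

definition polyhedron_of :: "(nat \<Rightarrow> real ^ 'n) \<Rightarrow> (nat \<Rightarrow> real) \<Rightarrow> nat set \<Rightarrow> (real ^ 'n) set" where
  "polyhedron_of a b I = {z. \<forall>i\<in>I. a i \<bullet> z + b i \<ge> 0}"

text \<open>Since \<open>h\<close> ignores the second component, a point \<open>z\<close> of the
  polyhedron lifts to the state \<open>(z, 0)\<close>.\<close>

lemma polyhedron_of_subset_proj_desired_set:
  assumes "l \<in> L"
  shows "polyhedron_of a b (J l) \<subseteq> fst ` desired_set a b L J"
proof
  fix z assume "z \<in> polyhedron_of a b (J l)"
  then have "(z, 0) \<in> desired_set a b L J"
    using assms by (auto simp: polyhedron_of_def desired_set_def half_space_def h_def)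
  then show "z \<in> fst ` desired_set a b L J"
    by force
qed

text \<open>A nonnegative maximum has a nonnegative term, and a nonnegative minimum has only such
  terms. Since \<open>J_bar\<close> pairs each \<open>i\<close> with \<open>i + r\<close>, the same
  \<open>l\<close> serves both families of inequalities.\<close>

lemma safe_set_obtain_index:
  assumes "index_sets r L J" and "x \<in> safe_set r a b L J \<gamma> \<epsilon>"
  obtains l where "l \<in> L"
    and "\<And>i. i \<in> J l \<Longrightarrow> a i \<bullet> fst x + b i \<ge> 0"
    and "\<And>i. i \<in> J l \<Longrightarrow> a i \<bullet> snd x + \<gamma> * (a i \<bullet> fst x + b i) \<ge> \<epsilon>"
proof -
  have L: "finite L" "L \<noteq> {}" and J: "\<And>l. l \<in> L \<Longrightarrow> J l \<subseteq> {1..r} \<and> J l \<noteq> {}"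
    using assms(1) by (auto simp: index_sets_def)
  have "0 \<le> (MAX l\<in>L. MIN k\<in>J_bar r J l. B_comp r a b \<gamma> \<epsilon> k x)"
    using assms(2) by (simp add: safe_set_def B_def)
  then obtain l where l: "l \<in> L" and min: "0 \<le> (MIN k\<in>J_bar r J l. B_comp r a b \<gamma> \<epsilon> k x)"
    using L by (auto simp: Max_ge_iff)
  have "finite (J l)"
    using J[OF l] finite_subset by blast
  then have "finite (J_bar r J l)" "J_bar r J l \<noteq> {}"
    using J[OF l] by (auto simp: J_bar_def)
  then have nonneg: "0 \<le> B_comp r a b \<gamma> \<epsilon> k x" if "k \<in> J_bar r J l" for k
    using min that by simp
  show thesis
  proof
    show "l \<in> L" by (fact l)
    fix i assume i: "i \<in> J l"
    \<comment> \<open>These bounds select the branches of \<open>B_comp\<close>: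
      \<open>i \<le> r\<close> gives the first, and \<open>1 \<le> i\<close> puts
      \<open>i + r\<close> beyond \<open>r\<close>, in the second.\<close>
    then have ir: "1 \<le> i" "i \<le> r"
      using J[OF l] by auto
    show "a i \<bullet> fst x + b i \<ge> 0"
      using nonneg[of i] i ir by (simp add: J_bar_def B_comp_def h_def)
    show "a i \<bullet> snd x + \<gamma> * (a i \<bullet> fst x + b i) \<ge> \<epsilon>"
      using nonneg[of "i + r"] i ir by (auto simp: J_bar_def B_comp_def)
  qed
qed

lemma norm_snd_safe_set_le_diameter:
  assumes "index_sets r L J" and "bounded (fst ` desired_set a b L J)"
    and "\<gamma> > 0" and "\<epsilon> \<ge> 0" and "x \<in> safe_set r a b L J \<gamma> \<epsilon>"
  obtains l where "l \<in> L" and "norm (snd x) \<le> \<gamma> * diameter (polyhedron_of a b (J l))"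
proof -
  obtain l where l: "l \<in> L"
    and x1: "\<And>i. i \<in> J l \<Longrightarrow> a i \<bullet> fst x + b i \<ge> 0"
    and x2: "\<And>i. i \<in> J l \<Longrightarrow> a i \<bullet> snd x + \<gamma> * (a i \<bullet> fst x + b i) \<ge> \<epsilon>"
    using safe_set_obtain_index[OF assms(1,5)] by blast
  \<comment> \<open>The scale 1 / \<gamma> makes
    \<open>a i \<bullet> snd x + \<gamma> * (a i \<bullet> fst x + b i)\<close> equal to \<gamma>
    times \<open>a i \<bullet> ?z + b i\<close>.\<close>
  let ?z = "fst x + snd x /\<^sub>R \<gamma>"
  have "fst x \<in> polyhedron_of a b (J l)"
    using x1 by (simp add: polyhedron_of_def)
  moreover have "?z \<in> polyhedron_of a b (J l)"
    unfolding polyhedron_of_def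
  proof (intro CollectI ballI)
    fix i assume "i \<in> J l"
    have "0 \<le> (a i \<bullet> snd x + \<gamma> * (a i \<bullet> fst x + b i)) / \<gamma>"
      using x2[OF \<open>i \<in> J l\<close>] assms(3,4) by simp
    also have "\<dots> = a i \<bullet> ?z + b i"
      using assms(3) by (simp add: inner_add_right field_simps)
    finally show "0 \<le> a i \<bullet> ?z + b i" .
  qed
  \<comment> \<open>Boundedness makes \<open>diameter\<close> a genuine supremum of distances, hence
    an upper bound for \<open>dist (fst x) ?z\<close>.\<close>
  moreover have "bounded (polyhedron_of a b (J l))"
    using bounded_subset[OF assms(2) polyhedron_of_subset_proj_desired_set[OF l]] .
  ultimately have "dist (fst x) ?z \<le> diameter (polyhedron_of a b (J l))"
    by (intro diameter_bounded_bound)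
  then have "norm (snd x) \<le> \<gamma> * diameter (polyhedron_of a b (J l))"
    using assms(3) by (simp add: dist_norm field_simps)
  with l show thesis by (rule that)
qed

text \<open>That the constant depends only on the half-space data is expressed by choosing
  \<open>c\<close> before \<open>L\<close>, \<open>J\<close>, \<open>y\<close>, \<gamma> and
  \<epsilon>.\<close>

theorem mainTheorem6:
  fixes r :: nat
    and a :: "nat \<Rightarrow> real ^ 'n"
    and b :: "nat \<Rightarrow> real"
  assumes "halfspace_data r a b"
  shows "\<exists>c::real. \<forall>(L :: nat set) (J :: nat \<Rightarrow> nat set) (y :: nat set \<Rightarrow> 'n state).
           index_sets r L J \<and> desired_set a b L J \<noteq> {} \<and> assumption1 r a b L J y \<longrightarrow>
           (\<forall>\<gamma>>0. \<forall>\<epsilon>>0. \<gamma> * delta r a b L J y > \<epsilon> \<longrightarrow>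
              (\<forall>x\<in>safe_set r a b L J \<gamma> \<epsilon>. norm (snd x) \<le> \<gamma> * c))"
proof -
  \<comment> \<open>Unbounded polyhedra contribute only an unspecified real to this maximum, which is harmless.\<close>
  define c where "c = (MAX I\<in>Pow {1..r}. diameter (polyhedron_of a b I))"
  show ?thesis
  proof (intro exI[of _ c] allI impI ballI)
    fix L J and y :: "nat set \<Rightarrow> 'n state" and \<gamma> \<epsilon> :: real and x
    assume asm: "index_sets r L J \<and> desired_set a b L J \<noteq> {} \<and> assumption1 r a b L J y"
      and pos: "\<gamma> > 0" "\<epsilon> > 0" and x: "x \<in> safe_set r a b L J \<gamma> \<epsilon>"
    have "bounded (fst ` desired_set a b L J)"
      using asm by (auto simp: assumption1_def intro: compact_imp_bounded)
    then obtain l where l: "l \<in> L"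
      and le: "norm (snd x) \<le> \<gamma> * diameter (polyhedron_of a b (J l))"
      using norm_snd_safe_set_le_diameter[of r L J a b \<gamma> \<epsilon> x] asm pos x by auto
    \<comment> \<open>Taking the maximum over all subsets of \<open>{1..r}\<close>, not just the
      sets \<open>J l\<close>, is what frees \<open>c\<close> from \<open>L\<close> and
      \<open>J\<close>.\<close>
    have "J l \<in> Pow {1..r}"
      using asm l by (auto simp: index_sets_def)
    then have "diameter (polyhedron_of a b (J l)) \<le> c"
      unfolding c_def by (intro Max_ge) auto
    then show "norm (snd x) \<le> \<gamma> * c"
      using le pos by (meson mult_left_mono order.trans less_imp_le)
  qed
qed

end
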